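(* Let $f$ be a continuous $1$-periodic real-valued function with $\min f>0$ and Fourier coefficients $a_k=\int_{-1/2}^{1/2}f(\omega)e^{2\pi i\omega k}\,d\omega$, and let $A_n=(a_{k-l})_{k,l=0}^{n-1}$ be the associated hermitian Toeplitz matrices, $n\ge1$. Assume the entries decay exponentially, i.e. there are constants $C>0$, $\gamma>0$ with $|a_k|\le C\,e^{-\gamma|k|}$ for all $k$. Set $S_n=A_n-B_nA_n^{-1}B_n^*$, where $B_n$ is the off-diagonal block of the circulant embedding of $A_n$ (defined in the context). Then for all $\varepsilon>0$ there exist $N$ and $M$ such that for all $n>N$ at most $M$ eigenvalues of $A_n-S_n$ have absolute value exceeding $\varepsilon$.
   Context: The circulant embedding of $A_n$ is the $2n\times 2n$ hermitian circulant matrix $$C_{2n}=\begin{bmatrix}A_n & B_n^*\\ B_n & A_n\end{bmatrix},$$ where $B_n$ is the $n\times n$ Toeplitz matrix whose first row is $(b_0,b_1,\dots,b_{n-1})$ with $b_k=a_{n-k}$ for $k=1,\dots,n-1$, and with $b_0=a_n$ (when $a_n$ is real) or $b_0=0$; the remaining entries of $B_n$ are determined by $C_{2n}$ being a hermitian circulant. Explicitly, $(C_{2n})_{kl}=c_{(k-l)\bmod 2n}$ with $c_j=a_j$ for $0\le j\le n-1$, $c_n=b_0$, and $c_j=\overline{a_{2n-j}}$ for $n+1\le j\le 2n-1$. Eigenvalues are counted with multiplicity. *)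

theory Defs
  imports
    "HOL-Analysis.Analysis"
    "Jordan_Normal_Form.Schur_Decomposition"
    "Jordan_Normal_Form.Gauss_Jordan_Elimination"
begin

definition fourier_coeff :: "(real \<Rightarrow> real) \<Rightarrow> int \<Rightarrow> complex" where
  "fourier_coeff f k =
     integral {-1/2..1/2}
       (\<lambda>\<omega>. complex_of_real (f \<omega>) * exp (2 * complex_of_real pi * \<i> * complex_of_real \<omega> * of_int k))"

definition toeplitz_mat :: "(int \<Rightarrow> complex) \<Rightarrow> nat \<Rightarrow> complex mat" where
  "toeplitz_mat a n = Matrix.mat n n (\<lambda>(k, l). a (int k - int l))"

text \<open>The sequence \<open>c\<close> of length \<open>2n\<close> generating the circulant; \<open>\<beta>\<close> is the
  free entry \<open>b\<^sub>0\<close>, which is \<open>a\<^sub>n\<close> (if real) or \<open>0\<close>.\<close>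

definition circulant_seq :: "(int \<Rightarrow> complex) \<Rightarrow> complex \<Rightarrow> nat \<Rightarrow> nat \<Rightarrow> complex" where
  "circulant_seq a \<beta> n j =
     (if j < n then a (int j) else if j = n then \<beta> else cnj (a (int (2 * n) - int j)))"

definition circulant_embedding :: "(int \<Rightarrow> complex) \<Rightarrow> complex \<Rightarrow> nat \<Rightarrow> complex mat" where
  "circulant_embedding a \<beta> n =
     Matrix.mat (2 * n) (2 * n)
       (\<lambda>(k, l). circulant_seq a \<beta> n (nat ((int k - int l) mod int (2 * n))))"

definition embedding_block :: "(int \<Rightarrow> complex) \<Rightarrow> complex \<Rightarrow> nat \<Rightarrow> complex mat" where
  "embedding_block a \<beta> n = Matrix.mat n n (\<lambda>(k, l). circulant_embedding a \<beta> n $$ (n + k, l))"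

lemma circulant_embedding_blocks:
  assumes herm: "\<And>k. a (- k) = cnj (a k)" and real: "\<beta> \<in> \<real>"
  shows "circulant_embedding a \<beta> n =
    four_block_mat (toeplitz_mat a n) (mat_adjoint (embedding_block a \<beta> n))
                   (embedding_block a \<beta> n) (toeplitz_mat a n)"
proof -
  have adj: "mat_adjoint (embedding_block a \<beta> n) =
      Matrix.mat n n (\<lambda>(k, l). cnj (circulant_embedding a \<beta> n $$ (n + l, k)))"
    by (rule eq_matI)
      (auto simp: mat_adjoint_def embedding_block_def mat_of_rows_def Matrix.row_def)
  have lo: "circulant_seq a \<beta> n (nat (d mod int (2 * n))) = a d"
    if "\<bar>d\<bar> < int n" for d
  proof (cases "0 \<le> d")
    case True
    then have "d mod int (2 * n) = d" using that by (intro mod_pos_pos_trivial) auto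
    then show ?thesis using True that by (auto simp: circulant_seq_def)
  next
    case False
    have "d mod int (2 * n) = (d + int (2 * n)) mod int (2 * n)" by simp
    also have "\<dots> = d + int (2 * n)" using False that by (intro mod_pos_pos_trivial) auto
    finally show ?thesis using False that herm[of "- d"] by (auto simp: circulant_seq_def)
  qed
  have up: "circulant_seq a \<beta> n (nat (d mod int (2 * n))) =
      cnj (circulant_seq a \<beta> n (nat (- d mod int (2 * n))))"
    if "- int (2 * n) < d" "d < 0" for d
  proof -
    have 1: "- d mod int (2 * n) = - d" using that by (intro mod_pos_pos_trivial) auto
    have "d mod int (2 * n) = (d + int (2 * n)) mod int (2 * n)" by simp
    also have "\<dots> = d + int (2 * n)" using that by (intro mod_pos_pos_trivial) auto
    finally have 2: "d mod int (2 * n) = d + int (2 * n)" .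
    show ?thesis unfolding 1 2 using that real
      by (auto simp: circulant_seq_def Reals_cnj_iff nat_less_iff add.commute)
  qed
  show ?thesis
  proof (rule eq_matI)
    fix i j
    assume "i < dim_row (four_block_mat (toeplitz_mat a n) (mat_adjoint (embedding_block a \<beta> n))
                   (embedding_block a \<beta> n) (toeplitz_mat a n))"
      "j < dim_col (four_block_mat (toeplitz_mat a n) (mat_adjoint (embedding_block a \<beta> n))
                   (embedding_block a \<beta> n) (toeplitz_mat a n))"
    then have ij: "i < 2 * n" "j < 2 * n" by (auto simp: toeplitz_mat_def)
    consider "i < n" "j < n" | "i < n" "j \<ge> n" | "i \<ge> n" "j < n" | "i \<ge> n" "j \<ge> n"
      by linarith
    then show "circulant_embedding a \<beta> n $$ (i, j) =
        four_block_mat (toeplitz_mat a n) (mat_adjoint (embedding_block a \<beta> n))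
                   (embedding_block a \<beta> n) (toeplitz_mat a n) $$ (i, j)"
    proof cases
      case 1
      then show ?thesis using lo[of "int i - int j"] ij
        by (simp add: adj circulant_embedding_def toeplitz_mat_def)
    next
      case 2
      then show ?thesis using up[of "int i - int j"] ij
        by (simp add: adj circulant_embedding_def toeplitz_mat_def)
    next
      case 3
      then show ?thesis using ij
        by (simp add: adj embedding_block_def toeplitz_mat_def)
    next
      case 4
      then show ?thesis using lo[of "int i - int j"] ij
        by (simp add: adj circulant_embedding_def toeplitz_mat_def of_nat_diff)
    qed
  qed (auto simp: circulant_embedding_def toeplitz_mat_def)
qed

text \<open>\<open>S\<^sub>n\<close> is the Schur complement of \<open>A\<^sub>n\<close> in the circulant embedding.  The library's
  \<open>mat_inverse\<close> yields \<open>None\<close> exactly for singular matrices, so the value below is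
  meaningful when \<open>A\<^sub>n\<close> is invertible, as it is for a positive symbol.\<close>

definition embedding_schur :: "(int \<Rightarrow> complex) \<Rightarrow> complex \<Rightarrow> nat \<Rightarrow> complex mat" where
  "embedding_schur a \<beta> n =
     toeplitz_mat a n -
     embedding_block a \<beta> n * the (mat_inverse (toeplitz_mat a n)) *
       mat_adjoint (embedding_block a \<beta> n)"

text \<open>Algebraic multiplicities, which for hermitian matrices agree with the geometric ones.\<close>

definition count_eigenvalues_exceeding :: "complex mat \<Rightarrow> real \<Rightarrow> nat" where
  "count_eigenvalues_exceeding X \<epsilon> =
     (\<Sum>z | eigenvalue X z \<and> cmod z > \<epsilon>. Polynomial.order z (char_poly X))"

end

theory Submission
  imports Defs
begin

text \<open>
  The matrix \<open>A\<^sub>n - S\<^sub>n = B\<^sub>n A\<^sub>n\<^sup>-\<^sup>1 B\<^sub>n\<^sup>*\<close> is positive semidefinite, so \<open>\<epsilon>\<close> times the number of its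
  eigenvalues above \<open>\<epsilon>\<close> is at most its trace. By Parseval \<open>A\<^sub>n \<ge> \<delta> I\<close> with \<open>\<delta> = min f\<close>, so the
  trace is at most the squared Frobenius norm of \<open>B\<^sub>n\<close> divided by \<open>\<delta>\<close>. The entries of \<open>B\<^sub>n\<close>
  satisfy \<open>|(B\<^sub>n)\<^sub>k\<^sub>l| \<le> C exp (- \<gamma> (n - |k - l|))\<close>, so this norm is bounded uniformly in \<open>n\<close>: exponential
  decay makes the matrices bounded in trace norm.
\<close>

unbundle no vec_syntax

section \<open>Counting eigenvalues by the trace\<close>

lemma order_linear_factor:
  fixes z e :: complex
  shows "Polynomial.order z [:- e, 1:] = (if z = e then 1 else 0)"
  using order_power_n_n[of e 1] by (auto intro: order_0I)

text \<open>Markov's inequality for roots with multiplicity: a list member in \<open>S\<close> adds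
  1 to the count and more than \<epsilon> to the sum, any other member only a nonnegative amount to
  the sum. An arbitrary \<open>S\<close> can stay fixed during the induction on the list.\<close>

lemma order_prod_linear_factors_le:
  fixes es :: "complex list" and S :: "complex set" and \<epsilon> :: real
  assumes "finite S" and "\<And>z. z \<in> S \<Longrightarrow> cmod z > \<epsilon>"
    and "\<And>e. e \<in> set es \<Longrightarrow> e \<in> \<real> \<and> Re e \<ge> 0"
  shows "\<epsilon> * real (\<Sum>z\<in>S. Polynomial.order z (\<Prod>e\<leftarrow>es. [:- e, 1:])) \<le> Re (sum_list es)"
  using assms(3)
proof (induction es)
  case Nil
  then show ?case by simp
next
  case (Cons e es)
  let ?p = "\<Prod>e\<leftarrow>es. [:- e, 1:]"
  have p0: "?p \<noteq> 0"
    by (auto simp: prod_list_zero_iff)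
  have ord: "Polynomial.order z ([:- e, 1:] * ?p) = (if z = e then 1 else 0) + Polynomial.order z ?p" for z
    using p0 by (subst order_mult) (auto simp: order_linear_factor simp del: mult_pCons_left)
  have e: "cmod e = Re e" "Re e \<ge> 0"
    using Cons.prems[of e] by (auto simp: complex_is_Real_iff cmod_def)
  have "real (\<Sum>z\<in>S. Polynomial.order z ([:- e, 1:] * ?p)) =
      (if e \<in> S then 1 else 0) + real (\<Sum>z\<in>S. Polynomial.order z ?p)"
    unfolding ord sum.distrib using assms(1) by simp
  moreover have "\<epsilon> * (if e \<in> S then 1 else 0) \<le> Re e"
    using e assms(2)[of e] by auto
  ultimately show ?case
    using Cons by (auto simp: algebra_simps)
qed

text \<open>Schur triangularization puts \<open>es\<close> on the diagonal of a matrix similar to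
  \<open>A\<close>, and similarity preserves the trace because tr(XY) = tr(YX).\<close>

lemma trace_eq_sum_eigenvalues:
  fixes A :: "complex mat"
  assumes A: "A \<in> carrier_mat n n" and c: "char_poly A = (\<Prod>e\<leftarrow>es. [:- e, 1:])"
  shows "(\<Sum>i<n. A $$ (i, i)) = sum_list es"
proof -
  obtain T P Q where T: "schur_decomposition A es = (T, P, Q)"
    by (cases "schur_decomposition A es") auto
  from schur_decomposition[OF A c T]
  have sim: "similar_mat_wit A T P Q" and es: "diag_mat T = es" by auto
  note w = similar_mat_witD2[OF A sim]
  have swap: "(\<Sum>i<n. (X * Y) $$ (i, i)) = (\<Sum>i<n. (Y * X) $$ (i, i))"
    if X: "X \<in> carrier_mat n n" and Y: "Y \<in> carrier_mat n n" for X Y :: "complex mat"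
  proof -
    have "(\<Sum>i<n. (X * Y) $$ (i, i)) = (\<Sum>i<n. \<Sum>j<n. X $$ (i, j) * Y $$ (j, i))"
      using X Y by (auto simp: scalar_prod_def atLeast0LessThan intro!: sum.cong)
    also have "\<dots> = (\<Sum>j<n. \<Sum>i<n. Y $$ (j, i) * X $$ (i, j))"
      by (subst sum.swap) (simp add: mult.commute)
    also have "\<dots> = (\<Sum>i<n. (Y * X) $$ (i, i))"
      using X Y by (auto simp: scalar_prod_def atLeast0LessThan intro!: sum.cong)
    finally show ?thesis .
  qed
  have "A = P * (T * Q)"
    using w(3,5-7) by simp
  then have "(\<Sum>i<n. A $$ (i, i)) = (\<Sum>i<n. (P * (T * Q)) $$ (i, i))"
    by simp
  also have "\<dots> = (\<Sum>i<n. (T * Q * P) $$ (i, i))"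
    using w(5-7) by (intro swap) auto
  also have "T * Q * P = T"
    using w(2,5-7) by (metis assoc_mult_mat right_mult_one_mat)
  also have "(\<Sum>i<n. T $$ (i, i)) = sum_list es"
    using w(5) unfolding es[symmetric] diag_mat_def
    by (simp add: interv_sum_list_conv_sum_set_nat atLeast0LessThan)
  finally show ?thesis .
qed

lemma count_eigenvalues_exceeding_le_trace:
  fixes A :: "complex mat"
  assumes A: "A \<in> carrier_mat n n"
    and ev: "\<And>z. eigenvalue A z \<Longrightarrow> z \<in> \<real> \<and> Re z \<ge> 0"
  shows "\<epsilon> * real (count_eigenvalues_exceeding A \<epsilon>) \<le> Re (\<Sum>i<n. A $$ (i, i))"
proof -
  obtain es where es: "char_poly A = (\<Prod>e\<leftarrow>es. [:- e, 1:])"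
    using char_poly_factorized[OF A] by auto
  have root: "eigenvalue A z \<longleftrightarrow> z \<in> set es" for z
    unfolding eigenvalue_root_char_poly[OF A] es
    by (auto simp: poly_prod_list prod_list_zero_iff)
  show ?thesis
    unfolding count_eigenvalues_exceeding_def trace_eq_sum_eigenvalues[OF A es] es
    by (rule order_prod_linear_factors_le) (use ev in \<open>auto simp: root\<close>)
qed

section \<open>Inverses of coercive matrices\<close>

text \<open>No hermitian symmetry is demanded separately: it is encoded in the form being real.\<close>

definition coercive_form :: "nat \<Rightarrow> complex mat \<Rightarrow> real \<Rightarrow> bool" where
  "coercive_form n A \<delta> \<longleftrightarrow> (\<forall>z :: nat \<Rightarrow> complex. \<exists>r.
     (\<Sum>k<n. \<Sum>l<n. cnj (z k) * A $$ (k, l) * z l) = complex_of_real r \<and>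
     \<delta> * (\<Sum>k<n. (cmod (z k))\<^sup>2) \<le> r)"

text \<open>A kernel vector makes the form vanish, so coercivity forces it to be zero. Hence
  \<open>mat_inverse A\<close> is not \<open>None\<close>, and \<open>the\<close> returns a genuine
  inverse.\<close>

lemma coercive_form_mat_inverse:
  assumes A: "A \<in> carrier_mat n n" and co: "coercive_form n A \<delta>" and \<delta>: "\<delta> > 0"
  shows "the (mat_inverse A) \<in> carrier_mat n n" "A * the (mat_inverse A) = 1\<^sub>m n"
proof -
  have "det A \<noteq> 0"
  proof
    assume "det A = 0"
    then obtain v where v: "v \<in> carrier_vec n" "v \<noteq> 0\<^sub>v n" "A *\<^sub>v v = 0\<^sub>v n"
      using det_0_iff_vec_prod_zero[OF A] by auto
    have 0: "(\<Sum>l<n. A $$ (k, l) * v $ l) = 0" if "k < n" for k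
    proof -
      have "(A *\<^sub>v v) $ k = 0" using v that by simp
      then show ?thesis
        using that A v(1) by (simp add: scalar_prod_def atLeast0LessThan)
    qed
    have "(\<Sum>k<n. \<Sum>l<n. cnj (v $ k) * A $$ (k, l) * v $ l) =
        (\<Sum>k<n. cnj (v $ k) * (\<Sum>l<n. A $$ (k, l) * v $ l))"
      by (simp add: sum_distrib_left mult.assoc)
    then have "\<delta> * (\<Sum>k<n. (cmod (v $ k))\<^sup>2) \<le> 0"
      using co[unfolded coercive_form_def, rule_format, of "\<lambda>k. v $ k"] 0 by auto
    then have "(\<Sum>k<n. (cmod (v $ k))\<^sup>2) \<le> 0"
      using \<delta> by (simp add: mult_le_0_iff)
    then have "(\<Sum>k<n. (cmod (v $ k))\<^sup>2) = 0"
      by (intro antisym sum_nonneg) auto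
    then have "\<forall>k<n. v $ k = 0"
      by (subst (asm) sum_nonneg_eq_0_iff) auto
    then show False using v by auto
  qed
  \<comment> \<open>\<open>undefined\<close> fills a free parameter of the matrix ring, so that both
    facts on units concern the same ring.\<close>
  from det_non_zero_imp_unit[OF A this, of undefined] mat_inverse(1)[OF A, of undefined]
  obtain B where "mat_inverse A = Some B" by (cases "mat_inverse A") auto
  with mat_inverse(2)[OF A this]
  show "the (mat_inverse A) \<in> carrier_mat n n" "A * the (mat_inverse A) = 1\<^sub>m n"
    by auto
qed

text \<open>Since y = A z, the sum is the form of the inverse at y. It equals r = z* A z, which is
  at least \<delta> |z|^2. Weighted AM-GM gives 2 r \<le> |y|^2 / \<delta> + \<delta> |z|^2, and the
  last term is absorbed by one r.\<close>

lemma coercive_form_solution: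
  fixes y z :: "nat \<Rightarrow> complex"
  assumes co: "coercive_form n A \<delta>" and \<delta>: "\<delta> > 0"
    and y: "\<And>k. k < n \<Longrightarrow> y k = (\<Sum>l<n. A $$ (k, l) * z l)"
  shows "\<exists>s. (\<Sum>k<n. cnj (y k) * z k) = complex_of_real s \<and> 0 \<le> s \<and>
    s \<le> (\<Sum>k<n. (cmod (y k))\<^sup>2) / \<delta>"
proof -
  obtain r where r: "(\<Sum>k<n. \<Sum>l<n. cnj (z k) * A $$ (k, l) * z l) = complex_of_real r"
    "\<delta> * (\<Sum>k<n. (cmod (z k))\<^sup>2) \<le> r"
    using co unfolding coercive_form_def by blast
  have "(\<Sum>k<n. cnj (z k) * y k) = complex_of_real r"
    unfolding r(1)[symmetric] by (simp add: y sum_distrib_left mult.assoc)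
  then have "cnj (\<Sum>k<n. cnj (z k) * y k) = complex_of_real r" by simp
  then have yz: "(\<Sum>k<n. cnj (y k) * z k) = complex_of_real r"
    by (simp add: mult.commute)
  have r0: "0 \<le> r"
    using r(2) \<delta> by (meson mult_nonneg_nonneg order_trans less_imp_le sum_nonneg zero_le_power2)
  have am_gm: "2 * Re (cnj (y k) * z k) \<le> (cmod (y k))\<^sup>2 / \<delta> + \<delta> * (cmod (z k))\<^sup>2" for k
  proof -
    have "Re (cnj (y k) * z k) \<le> cmod (y k) * cmod (z k)"
      using complex_Re_le_cmod[of "cnj (y k) * z k"] by (simp add: norm_mult)
    moreover have "0 \<le> (cmod (y k) - \<delta> * cmod (z k))\<^sup>2 / \<delta>"
      using \<delta> by simp
    then have "2 * (cmod (y k) * cmod (z k)) \<le> (cmod (y k))\<^sup>2 / \<delta> + \<delta> * (cmod (z k))\<^sup>2"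
      using \<delta> by (simp add: power2_eq_square field_simps)
    ultimately show ?thesis by linarith
  qed
  have "2 * r = (\<Sum>k<n. 2 * Re (cnj (y k) * z k))"
    using arg_cong[OF yz, of Re] by (simp add: sum_distrib_left[symmetric])
  also have "\<dots> \<le> (\<Sum>k<n. (cmod (y k))\<^sup>2) / \<delta> + \<delta> * (\<Sum>k<n. (cmod (z k))\<^sup>2)"
    unfolding sum_divide_distrib sum_distrib_left sum.distrib[symmetric]
    by (intro sum_mono am_gm)
  finally show ?thesis using yz r0 r(2) by (intro exI[of _ r]) auto
qed

text \<open>With y = B* x and z = A^-1 y, the form of \<open>M\<close> at x is y* z, which the
  preceding lemma controls. The lower bound serves the eigenvalues of \<open>M\<close>, the upper
  bound its diagonal.\<close>

lemma congruence_inverse_form: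
  fixes x :: "nat \<Rightarrow> complex"
  assumes A: "A \<in> carrier_mat n n" and co: "coercive_form n A \<delta>" and \<delta>: "\<delta> > 0"
    and B: "B \<in> carrier_mat n n"
  defines "M \<equiv> B * the (mat_inverse A) * mat_adjoint B"
  shows "\<exists>s. (\<Sum>k<n. \<Sum>l<n. cnj (x k) * M $$ (k, l) * x l) = complex_of_real s \<and> 0 \<le> s \<and>
    s \<le> (\<Sum>k<n. (cmod (\<Sum>j<n. cnj (B $$ (j, k)) * x j))\<^sup>2) / \<delta>"
proof -
  define I where "I = the (mat_inverse A)"
  have I: "I \<in> carrier_mat n n" "A * I = 1\<^sub>m n"
    using coercive_form_mat_inverse[OF A co \<delta>] by (auto simp: I_def)
  have adj: "mat_adjoint B = Matrix.mat n n (\<lambda>(k, l). cnj (B $$ (l, k)))"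
    using B by (intro eq_matI) (auto simp: mat_adjoint_def mat_of_rows_def Matrix.row_def)
  define y where "y = (\<lambda>k. \<Sum>j<n. cnj (B $$ (j, k)) * x j)"
  define z where "z = (\<lambda>l. \<Sum>j<n. I $$ (l, j) * y j)"
  have AI: "(\<Sum>l<n. A $$ (k, l) * I $$ (l, j)) = (if k = j then 1 else 0)"
    if "k < n" "j < n" for k j
  proof -
    have "(A * I) $$ (k, j) = (if k = j then 1 else 0)" using I that by simp
    then show ?thesis using that A I(1) by (simp add: scalar_prod_def atLeast0LessThan)
  qed
  have "y k = (\<Sum>l<n. A $$ (k, l) * z l)" if k: "k < n" for k
  proof -
    have "(\<Sum>l<n. A $$ (k, l) * z l) = (\<Sum>l<n. \<Sum>j<n. A $$ (k, l) * I $$ (l, j) * y j)"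
      by (simp add: z_def sum_distrib_left mult.assoc)
    also have "\<dots> = (\<Sum>j<n. (\<Sum>l<n. A $$ (k, l) * I $$ (l, j)) * y j)"
      by (subst sum.swap) (simp add: sum_distrib_right)
    also have "\<dots> = (\<Sum>j<n. if k = j then y j else 0)"
      by (intro sum.cong) (auto simp: AI k)
    finally show ?thesis using k by simp
  qed
  note sol = coercive_form_solution[OF co \<delta> this]
  have M: "M $$ (k, l) = (\<Sum>p<n. \<Sum>q<n. B $$ (k, p) * I $$ (p, q) * cnj (B $$ (l, q)))"
    if "k < n" "l < n" for k l
  proof -
    have "M $$ (k, l) = (\<Sum>q<n. (\<Sum>p<n. B $$ (k, p) * I $$ (p, q)) * cnj (B $$ (l, q)))"
      unfolding M_def I_def[symmetric] adj using that B I(1)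
      by (simp add: scalar_prod_def atLeast0LessThan)
    then show ?thesis
      by (subst sum.swap) (simp add: sum_distrib_right)
  qed
  \<comment> \<open>The summation order k, l, p, q is turned into k, p, q, l: the sum over l then
    yields \<open>y q\<close>, the one over q yields \<open>z p\<close>, and finally the one over k
    yields \<open>cnj (y p)\<close>.\<close>
  have "(\<Sum>k<n. \<Sum>l<n. cnj (x k) * M $$ (k, l) * x l) =
      (\<Sum>k<n. \<Sum>l<n. \<Sum>p<n. \<Sum>q<n.
        cnj (x k) * B $$ (k, p) * I $$ (p, q) * cnj (B $$ (l, q)) * x l)"
    by (simp add: M sum_distrib_left sum_distrib_right mult.assoc)
  also have "\<dots> = (\<Sum>k<n. \<Sum>p<n. \<Sum>l<n. \<Sum>q<n.
        cnj (x k) * B $$ (k, p) * I $$ (p, q) * cnj (B $$ (l, q)) * x l)"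
    by (intro sum.cong[OF refl] sum.swap)
  also have "\<dots> = (\<Sum>k<n. \<Sum>p<n. \<Sum>q<n. \<Sum>l<n.
        cnj (x k) * B $$ (k, p) * I $$ (p, q) * cnj (B $$ (l, q)) * x l)"
    by (intro sum.cong[OF refl] sum.swap)
  also have "\<dots> = (\<Sum>k<n. \<Sum>p<n. cnj (x k) * B $$ (k, p) * z p)"
    by (simp add: z_def y_def sum_distrib_left mult.assoc)
  also have "\<dots> = (\<Sum>p<n. \<Sum>k<n. cnj (x k) * B $$ (k, p) * z p)"
    by (rule sum.swap)
  also have "\<dots> = (\<Sum>p<n. cnj (y p) * z p)"
    by (simp add: y_def sum_distrib_left sum_distrib_right mult_ac)
  finally have "(\<Sum>k<n. \<Sum>l<n. cnj (x k) * M $$ (k, l) * x l) = (\<Sum>p<n. cnj (y p) * z p)" .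
  with sol show ?thesis by (simp add: y_def)
qed

text \<open>Testing the form on an eigenvector shows its eigenvalue to be real and nonnegative, so
  the trace bound applies. Testing it on the i-th unit vector bounds the i-th diagonal entry by the
  squared norm of row i of \<open>B\<close> over \<delta>.\<close>

lemma count_eigenvalues_congruence_inverse:
  assumes A: "A \<in> carrier_mat n n" and co: "coercive_form n A \<delta>" and \<delta>: "\<delta> > 0"
    and B: "B \<in> carrier_mat n n"
  shows "\<epsilon> * real (count_eigenvalues_exceeding (B * the (mat_inverse A) * mat_adjoint B) \<epsilon>) \<le>
    (\<Sum>k<n. \<Sum>l<n. (cmod (B $$ (k, l)))\<^sup>2) / \<delta>"
proof -
  define M where "M = B * the (mat_inverse A) * mat_adjoint B"
  note form = congruence_inverse_form[OF A co \<delta> B, folded M_def]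
  have M: "M \<in> carrier_mat n n"
    using B by (auto simp: M_def mat_adjoint_def)
  have "z \<in> \<real> \<and> Re z \<ge> 0" if z: "eigenvalue M z" for z
  proof -
    obtain v where v: "v \<in> carrier_vec n" "v \<noteq> 0\<^sub>v n" "M *\<^sub>v v = z \<cdot>\<^sub>v v"
      using z carrier_matD(1)[OF M] unfolding eigenvalue_def eigenvector_def by auto
    have ev: "(\<Sum>l<n. M $$ (k, l) * v $ l) = z * v $ k" if "k < n" for k
    proof -
      have "(M *\<^sub>v v) $ k = z * v $ k" using v that by simp
      then show ?thesis
        using that M v(1) by (simp add: scalar_prod_def atLeast0LessThan)
    qed
    obtain s where s: "(\<Sum>k<n. \<Sum>l<n. cnj (v $ k) * M $$ (k, l) * v $ l) = complex_of_real s" "0 \<le> s"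
      using form[of "\<lambda>k. v $ k"] by blast
    define N where "N = (\<Sum>k<n. (cmod (v $ k))\<^sup>2)"
    obtain k where "k < n" "v $ k \<noteq> 0"
      using v by (metis carrier_vecD eq_vecI index_zero_vec)
    then have N: "N > 0"
      unfolding N_def by (intro sum_pos2[of _ k]) auto
    have "complex_of_real s = (\<Sum>k<n. cnj (v $ k) * (\<Sum>l<n. M $$ (k, l) * v $ l))"
      by (simp add: s(1)[symmetric] sum_distrib_left mult.assoc)
    also have "\<dots> = (\<Sum>k<n. z * complex_of_real ((cmod (v $ k))\<^sup>2))"
    proof (intro sum.cong refl)
      fix k assume "k \<in> {..<n}"
      then show "cnj (v $ k) * (\<Sum>l<n. M $$ (k, l) * v $ l) = z * complex_of_real ((cmod (v $ k))\<^sup>2)"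
        unfolding complex_norm_square by (simp only: ev lessThan_iff) (simp only: mult_ac)
    qed
    also have "\<dots> = z * complex_of_real N"
      by (simp add: N_def sum_distrib_left)
    \<comment> \<open>The eigenvalue is the Rayleigh quotient of its eigenvector.\<close>
    finally have "z = complex_of_real (s / N)"
      using N by (simp add: field_simps)
    then show ?thesis using s(2) N by simp
  qed
  from count_eigenvalues_exceeding_le_trace[OF M this, of \<epsilon>]
  have "\<epsilon> * real (count_eigenvalues_exceeding M \<epsilon>) \<le> (\<Sum>i<n. Re (M $$ (i, i)))"
    by simp
  also have "\<dots> \<le> (\<Sum>i<n. (\<Sum>k<n. (cmod (B $$ (i, k)))\<^sup>2) / \<delta>)"
  proof (rule sum_mono)
    fix i assume "i \<in> {..<n}"
    then have i: "i < n" by simp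
    define x where "x = (\<lambda>k. if k = i then 1 else 0 :: complex)"
    have "(\<Sum>k<n. \<Sum>l<n. cnj (x k) * M $$ (k, l) * x l) =
        (\<Sum>k<n. \<Sum>l<n. if l = i then if k = i then M $$ (k, l) else 0 else 0)"
      by (intro sum.cong) (auto simp: x_def)
    also have "\<dots> = M $$ (i, i)" using i by simp
    finally have 1: "(\<Sum>k<n. \<Sum>l<n. cnj (x k) * M $$ (k, l) * x l) = M $$ (i, i)" .
    have "(\<Sum>j<n. cnj (B $$ (j, k)) * x j) = (\<Sum>j<n. if j = i then cnj (B $$ (j, k)) else 0)" for k
      by (intro sum.cong) (auto simp: x_def)
    then have 2: "(\<Sum>j<n. cnj (B $$ (j, k)) * x j) = cnj (B $$ (i, k))" for k
      using i by simp
    show "Re (M $$ (i, i)) \<le> (\<Sum>k<n. (cmod (B $$ (i, k)))\<^sup>2) / \<delta>"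
      using form[of x] unfolding 1 2 by auto
  qed
  finally show ?thesis by (simp add: M_def sum_divide_distrib)
qed

section \<open>Toeplitz forms, Parseval's identity and the lower bound of the symbol\<close>

text \<open>Orthogonality of the exponentials, put in terms of the symbol 1: its Toeplitz matrix is
  the identity, so Parseval becomes a special case of the Toeplitz form.\<close>

lemma fourier_coeff_const: "fourier_coeff (\<lambda>_. 1) k = (if k = 0 then 1 else 0)"
proof (cases "k = 0")
  case True
  then show ?thesis by (simp add: fourier_coeff_def)
next
  case False
  define c where "c = 2 * complex_of_real pi * \<i> * of_int k"
  have c0: "c \<noteq> 0" using False by (simp add: c_def)
  have "((\<lambda>\<omega>. exp (c * complex_of_real \<omega>)) has_integral
      exp (c * complex_of_real (1/2)) / c - exp (c * complex_of_real (-1/2)) / c) {-1/2..1/2}"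
    by (rule fundamental_theorem_of_calculus)
      (auto intro!: derivative_eq_intros has_vector_derivative_real_field simp: c0)
  \<comment> \<open>The exponents at the two endpoints differ by 2 pi i k, a period of
    \<open>exp\<close>.\<close>
  moreover have "exp (c * complex_of_real (1/2)) = exp (c * complex_of_real (-1/2))"
    unfolding exp_eq by (intro exI[of _ k]) (simp add: c_def)
  ultimately have "integral {-1/2..1/2} (\<lambda>\<omega>. exp (c * complex_of_real \<omega>)) = 0"
    by (simp add: integral_unique)
  then show ?thesis using False by (simp add: fourier_coeff_def c_def mult_ac)
qed

text \<open>The exponents are negative because \<open>fourier_coeff\<close> uses positive ones: the
  Toeplitz form then contains the squared modulus of this polynomial with the coefficients z
  themselves, not their conjugates.\<close>

definition trig_poly :: "nat \<Rightarrow> (nat \<Rightarrow> complex) \<Rightarrow> real \<Rightarrow> complex" where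
  "trig_poly n z \<omega> =
     (\<Sum>l<n. z l * exp (- (2 * complex_of_real pi * \<i> * complex_of_real \<omega> * of_nat l)))"

lemma continuous_on_trig_poly [continuous_intros]: "continuous_on S (trig_poly n z)"
  unfolding trig_poly_def by (intro continuous_intros)

text \<open>The finite sums pass under the integral. There the exponential of index k - l splits
  into \<open>cnj (e k) * e l\<close>, so the double sum factors into a polynomial times its
  conjugate.\<close>

lemma toeplitz_form_integral:
  fixes g :: "real \<Rightarrow> real"
  assumes g: "continuous_on {-1/2..1/2} g"
  shows "(\<Sum>k<n. \<Sum>l<n. cnj (z k) * fourier_coeff g (int k - int l) * z l) =
    complex_of_real (integral {-1/2..1/2} (\<lambda>\<omega>. g \<omega> * (cmod (trig_poly n z \<omega>))\<^sup>2))"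
proof -
  define h where "h = (\<lambda>k l \<omega>. cnj (z k) * (complex_of_real (g \<omega>) *
    exp (2 * complex_of_real pi * \<i> * complex_of_real \<omega> * of_int (int k - int l))) * z l)"
  have hc: "continuous_on {-1/2..1/2} (h k l)" for k l
    unfolding h_def by (intro continuous_intros g)
  have "cnj (z k) * fourier_coeff g (int k - int l) * z l = integral {-1/2..1/2} (h k l)" for k l
    unfolding fourier_coeff_def h_def by simp
  then have "(\<Sum>k<n. \<Sum>l<n. cnj (z k) * fourier_coeff g (int k - int l) * z l) =
      integral {-1/2..1/2} (\<lambda>\<omega>. \<Sum>k<n. \<Sum>l<n. h k l \<omega>)"
    using hc by (simp add: integral_sum integrable_sum integrable_continuous_interval)
  also have "(\<lambda>\<omega>. \<Sum>k<n. \<Sum>l<n. h k l \<omega>) =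
      (\<lambda>\<omega>. complex_of_real (g \<omega> * (cmod (trig_poly n z \<omega>))\<^sup>2))"
  proof
    fix \<omega>
    define e where "e = (\<lambda>l. exp (- (2 * complex_of_real pi * \<i> * complex_of_real \<omega> * of_nat l)))"
    have e: "exp (2 * complex_of_real pi * \<i> * complex_of_real \<omega> * of_int (int k - int l)) =
        cnj (e k) * e l" for k l
      unfolding e_def exp_cnj mult_exp_exp by (simp add: algebra_simps)
    have "complex_of_real ((cmod (trig_poly n z \<omega>))\<^sup>2) =
        cnj (\<Sum>k<n. z k * e k) * (\<Sum>l<n. z l * e l)"
      unfolding trig_poly_def e_def by (simp only: complex_norm_square mult.commute)
    also have "\<dots> = (\<Sum>k<n. \<Sum>l<n. cnj (z k) * (cnj (e k) * e l) * z l)"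
      unfolding cnj_sum sum_product by (simp add: mult_ac)
    finally have P: "complex_of_real ((cmod (trig_poly n z \<omega>))\<^sup>2) =
        (\<Sum>k<n. \<Sum>l<n. cnj (z k) * (cnj (e k) * e l) * z l)" .
    have "h k l \<omega> = complex_of_real (g \<omega>) * (cnj (z k) * (cnj (e k) * e l) * z l)" for k l
      by (simp only: h_def e) (simp only: mult_ac)
    then show "(\<Sum>k<n. \<Sum>l<n. h k l \<omega>) = complex_of_real (g \<omega> * (cmod (trig_poly n z \<omega>))\<^sup>2)"
      by (simp only: P of_real_mult sum_distrib_left)
  qed
  also have "integral {-1/2..1/2} \<dots> =
      complex_of_real (integral {-1/2..1/2} (\<lambda>\<omega>. g \<omega> * (cmod (trig_poly n z \<omega>))\<^sup>2))"
    by (rule integral_linear[OF _ bounded_linear_of_real, unfolded o_def])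
      (intro integrable_continuous_interval continuous_intros g)
  finally show ?thesis .
qed

lemma integral_cmod_trig_poly:
  "integral {-1/2..1/2} (\<lambda>\<omega>. (cmod (trig_poly n z \<omega>))\<^sup>2) = (\<Sum>k<n. (cmod (z k))\<^sup>2)"
proof -
  have "complex_of_real (integral {-1/2..1/2} (\<lambda>\<omega>. (cmod (trig_poly n z \<omega>))\<^sup>2)) =
      (\<Sum>k<n. \<Sum>l<n. cnj (z k) * (if k = l then 1 else 0) * z l)"
    using toeplitz_form_integral[of "\<lambda>_. 1" z n] by (simp add: fourier_coeff_const)
  also have "\<dots> = (\<Sum>k<n. \<Sum>l<n. if k = l then cnj (z k) * z k else 0)"
    by (intro sum.cong) auto
  also have "\<dots> = complex_of_real (\<Sum>k<n. (cmod (z k))\<^sup>2)"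
    by (simp add: complex_norm_square mult.commute del: of_real_power)
  finally show ?thesis unfolding of_real_eq_iff .
qed

text \<open>The symbol is compared with \<delta> under the integral, and Parseval evaluates the
  integral for the constant \<delta>.\<close>

lemma coercive_form_toeplitz:
  assumes f: "continuous_on {-1/2..1/2} f" and ge: "\<And>\<omega>. \<delta> \<le> f \<omega>"
  shows "coercive_form n (toeplitz_mat (fourier_coeff f) n) \<delta>"
  unfolding coercive_form_def
proof (intro allI exI conjI)
  fix z :: "nat \<Rightarrow> complex"
  show "(\<Sum>k<n. \<Sum>l<n. cnj (z k) * toeplitz_mat (fourier_coeff f) n $$ (k, l) * z l) =
      complex_of_real (integral {-1/2..1/2} (\<lambda>\<omega>. f \<omega> * (cmod (trig_poly n z \<omega>))\<^sup>2))"
    using toeplitz_form_integral[OF f, of z n] by (simp add: toeplitz_mat_def)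
  have "\<delta> * (\<Sum>k<n. (cmod (z k))\<^sup>2) = integral {-1/2..1/2} (\<lambda>\<omega>. \<delta> * (cmod (trig_poly n z \<omega>))\<^sup>2)"
    by (simp only: integral_mult_right integral_cmod_trig_poly)
  also have "\<dots> \<le> integral {-1/2..1/2} (\<lambda>\<omega>. f \<omega> * (cmod (trig_poly n z \<omega>))\<^sup>2)"
    by (intro integral_le integrable_continuous_interval continuous_intros f mult_right_mono ge) auto
  finally show "\<delta> * (\<Sum>k<n. (cmod (z k))\<^sup>2) \<le>
      integral {-1/2..1/2} (\<lambda>\<omega>. f \<omega> * (cmod (trig_poly n z \<omega>))\<^sup>2)" .
qed

text \<open>\<open>INF\<close> over the reals is known to be a lower bound only when the range is
  bounded below. Periodicity places the whole range in the image of the compact interval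
  [0, 1].\<close>

lemma continuous_periodic_INF_le:
  fixes f :: "real \<Rightarrow> real"
  assumes "continuous_on UNIV f" and "\<And>\<omega>. f (\<omega> + 1) = f \<omega>"
  shows "(INF \<omega>. f \<omega>) \<le> f x"
proof -
  interpret periodic_fun_simple' f by standard (rule assms(2))
  have "compact (f ` {0..1})"
    by (intro compact_continuous_image continuous_on_subset[OF assms(1)]) auto
  then have "bdd_below (f ` {0..1})"
    by (intro bounded_imp_bdd_below compact_imp_bounded)
  moreover have "range f \<subseteq> f ` {0..1}"
  proof
    fix y assume "y \<in> range f"
    then obtain t where "y = f t" by auto
    then have "y = f (frac t)"
      using minus_of_int[of t "\<lfloor>t\<rfloor>"] by (simp add: frac_def)
    then show "y \<in> f ` {0..1}"
      using frac_ge_0[of t] frac_lt_1[of t] by auto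
  qed
  ultimately have "bdd_below (range f)" by (rule bdd_below_mono)
  then show ?thesis by (rule cINF_lower) auto
qed

section \<open>Size of the off-diagonal block\<close>

text \<open>Entry (k, l) is the circulant term of index n + k - l. For k < l this is the coefficient
  of index n - (l - k), for k > l the conjugate of that of index n - (k - l), and on the diagonal it
  is \<beta>. The bound is thus weakest in the two corners far from the diagonal.\<close>

lemma cmod_embedding_block_le:
  assumes decay: "\<And>k. cmod (a k) \<le> C * exp (- \<gamma> * \<bar>real_of_int k\<bar>)"
    and \<beta>: "cmod \<beta> \<le> C * exp (- \<gamma> * real n)"
    and kl: "k < n" "l < n"
  shows "cmod (embedding_block a \<beta> n $$ (k, l)) \<le> C * exp (- \<gamma> * (real n - \<bar>real k - real l\<bar>))"
proof -
  \<comment> \<open>The index lies strictly between 0 and 2n, so nothing wraps around.\<close>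
  have "(int (n + k) - int l) mod int (2 * n) = int (n + k) - int l"
    using kl by (intro mod_pos_pos_trivial) auto
  then have eq: "embedding_block a \<beta> n $$ (k, l) = circulant_seq a \<beta> n (n + k - l)"
    using kl by (simp add: embedding_block_def circulant_embedding_def nat_diff_distrib' flip: of_nat_add)
  consider "k < l" | "k = l" | "k > l" by linarith
  then show ?thesis
  proof cases
    case 1
    then have "n + k - l < n" using kl by linarith
    then show ?thesis using 1 decay[of "int (n + k - l)"] kl
      by (simp add: eq circulant_seq_def of_nat_diff algebra_simps)
  next
    case 2
    then show ?thesis using \<beta> eq by (simp add: circulant_seq_def)
  next
    case 3
    then have "\<not> n + k - l < n" "n + k - l \<noteq> n" using kl by linarith+
    then show ?thesis using 3 decay[of "int (2 * n) - int (n + k - l)"] kl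
      by (simp add: eq circulant_seq_def of_nat_diff algebra_simps)
  qed
qed

text \<open>The squares decay away from the two corners like r ^ (distance), with r = exp (-2
  \<gamma>). Each corner gives a product of two geometric sums, each at most 1 / (1 - r); the factor
  2 counts the corners.\<close>

lemma embedding_block_sum_squares_le:
  assumes C: "C > 0" and \<gamma>: "\<gamma> > 0"
    and decay: "\<And>k. cmod (a k) \<le> C * exp (- \<gamma> * \<bar>real_of_int k\<bar>)"
    and \<beta>: "cmod \<beta> \<le> C * exp (- \<gamma> * real n)"
  shows "(\<Sum>k<n. \<Sum>l<n. (cmod (embedding_block a \<beta> n $$ (k, l)))\<^sup>2) \<le>
    2 * C\<^sup>2 / (1 - exp (- 2 * \<gamma>))\<^sup>2"
proof -
  define r where "r = exp (- 2 * \<gamma>)"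
  have r: "0 < r" "r < 1" using \<gamma> by (auto simp: r_def)
  have r_pow: "exp (- 2 * \<gamma> * real m) = r ^ m" for m
    by (simp add: r_def mult.commute exp_of_nat_mult[symmetric])
  have le: "(cmod (embedding_block a \<beta> n $$ (k, l)))\<^sup>2 \<le>
      C\<^sup>2 * (r ^ (n - k) * r ^ l + r ^ k * r ^ (n - l))" if kl: "k < n" "l < n" for k l
  proof -
    \<comment> \<open>This is n - |k - l| as a natural number, split so that k and l occur in
      separate summands.\<close>
    define m where "m = (if l \<le> k then (n - k) + l else k + (n - l))"
    have m: "real n - \<bar>real k - real l\<bar> = real m"
      using kl by (auto simp: m_def)
    have "(cmod (embedding_block a \<beta> n $$ (k, l)))\<^sup>2 \<le> (C * exp (- \<gamma> * real m))\<^sup>2"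
      using cmod_embedding_block_le[OF decay \<beta> kl] unfolding m
      by (intro power_mono) auto
    also have "\<dots> = C\<^sup>2 * r ^ m"
      by (simp add: power_mult_distrib r_pow[symmetric] exp_double[symmetric] mult_ac)
    \<comment> \<open>One of the two products equals r ^ m and the other is nonnegative. Adding both
      removes the case distinction, so the double sum factors.\<close>
    also have "\<dots> \<le> C\<^sup>2 * (r ^ (n - k) * r ^ l + r ^ k * r ^ (n - l))"
      using r by (intro mult_left_mono) (auto simp: m_def power_add)
    finally show ?thesis .
  qed
  have g1: "(\<Sum>k<n. r ^ k) \<le> 1 / (1 - r)"
    using r by (simp add: sum_gp_strict divide_right_mono)
  \<comment> \<open>The exponents run from n down to 1; after reversal, each term loses one factor r
    and the previous geometric bound applies.\<close>
  have "(\<Sum>k<n. r ^ (n - k)) = (\<Sum>k<n. r ^ Suc k)"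
    by (rule sum.reindex_bij_witness[of _ "\<lambda>k. n - Suc k" "\<lambda>k. n - Suc k"])
      (auto simp: Suc_diff_Suc simp del: power_Suc)
  also have "\<dots> \<le> (\<Sum>k<n. r ^ k)"
    using r by (intro sum_mono power_decreasing) auto
  finally have g2: "(\<Sum>k<n. r ^ (n - k)) \<le> 1 / (1 - r)" using g1 by simp
  have "(\<Sum>k<n. \<Sum>l<n. (cmod (embedding_block a \<beta> n $$ (k, l)))\<^sup>2) \<le>
      (\<Sum>k<n. \<Sum>l<n. C\<^sup>2 * (r ^ (n - k) * r ^ l + r ^ k * r ^ (n - l)))"
    by (intro sum_mono le) auto
  also have "\<dots> = C\<^sup>2 * (2 * ((\<Sum>k<n. r ^ (n - k)) * (\<Sum>k<n. r ^ k)))"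
    by (simp add: sum_distrib_left[symmetric] sum_distrib_right[symmetric] sum.distrib)
  also have "\<dots> \<le> C\<^sup>2 * (2 * (1 / (1 - r) * (1 / (1 - r))))"
    using r g1 g2 by (intro mult_left_mono mult_mono) (auto intro: sum_nonneg)
  finally show ?thesis by (simp add: r_def power2_eq_square mult_ac)
qed

theorem theorem5p1:
  fixes f :: "real \<Rightarrow> real" and a :: "int \<Rightarrow> complex" and b0 :: "nat \<Rightarrow> complex"
    and C \<gamma> :: real
  assumes "continuous_on UNIV f"
    and "\<And>\<omega>. f (\<omega> + 1) = f \<omega>"
    and "(INF \<omega>. f \<omega>) > 0"
    and "\<And>k. a k = fourier_coeff f k"
    and "C > 0" and "\<gamma> > 0"
    and "\<And>k. cmod (a k) \<le> C * exp (- \<gamma> * \<bar>real_of_int k\<bar>)"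
    and "\<And>n. n \<ge> 1 \<Longrightarrow> b0 n = 0 \<or> (a (int n) \<in> \<real> \<and> b0 n = a (int n))"
  shows "\<forall>\<epsilon>>0. \<exists>N M. \<forall>n>N.
           count_eigenvalues_exceeding (toeplitz_mat a n - embedding_schur a (b0 n) n) \<epsilon> \<le> M"
proof (intro allI impI)
  fix \<epsilon> :: real assume \<epsilon>: "\<epsilon> > 0"
  define \<delta> where "\<delta> = (INF \<omega>. f \<omega>)"
  \<comment> \<open>The Frobenius bound divided by \<delta> and \<epsilon>, independent of
    n.\<close>
  define K where "K = 2 * C\<^sup>2 / (1 - exp (- 2 * \<gamma>))\<^sup>2 / \<delta> / \<epsilon>"
  have \<delta>: "\<delta> > 0" using assms(3) by (simp add: \<delta>_def)
  have co: "coercive_form n (toeplitz_mat a n) \<delta>" for n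
  proof -
    have "a = fourier_coeff f" using assms(4) by auto
    then show ?thesis
      using continuous_periodic_INF_le[OF assms(1,2)]
      by (auto simp: \<delta>_def intro!: coercive_form_toeplitz continuous_on_subset[OF assms(1)])
  qed
  \<comment> \<open>The witnesses will be N = 0 and M =
    \<open>nat \<lfloor>K\<rfloor>\<close>.\<close>
  have "count_eigenvalues_exceeding (toeplitz_mat a n - embedding_schur a (b0 n) n) \<epsilon> \<le> nat \<lfloor>K\<rfloor>"
    if n: "n > 0" for n
  proof -
    define A where "A = toeplitz_mat a n"
    define B where "B = embedding_block a (b0 n) n"
    define X where "X = B * the (mat_inverse A) * mat_adjoint B"
    have A: "A \<in> carrier_mat n n" and B: "B \<in> carrier_mat n n"
      by (auto simp: A_def B_def toeplitz_mat_def embedding_block_def)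
    have X: "X \<in> carrier_mat n n"
      using B by (auto simp: X_def mat_adjoint_def)
    have "toeplitz_mat a n - embedding_schur a (b0 n) n = A - (A - X)"
      by (simp add: embedding_schur_def A_def B_def X_def)
    also have "\<dots> = X"
      using A X by (intro eq_matI) auto
    finally have eq: "toeplitz_mat a n - embedding_schur a (b0 n) n = X" .
    \<comment> \<open>Both admissible values obey the decay bound: 0 trivially, and the coefficient
      of index n by the decay hypothesis at n.\<close>
    have b0: "cmod (b0 n) \<le> C * exp (- \<gamma> * real n)"
      using assms(8)[of n] assms(7)[of "int n"] assms(5) n by auto
    have "\<epsilon> * real (count_eigenvalues_exceeding X \<epsilon>) \<le>
        (\<Sum>k<n. \<Sum>l<n. (cmod (B $$ (k, l)))\<^sup>2) / \<delta>"
      unfolding X_def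
      by (rule count_eigenvalues_congruence_inverse[OF A co[of n, folded A_def] \<delta> B])
    also have "\<dots> \<le> 2 * C\<^sup>2 / (1 - exp (- 2 * \<gamma>))\<^sup>2 / \<delta>"
      using embedding_block_sum_squares_le[OF assms(5-7) b0] \<delta> 
      by (intro divide_right_mono) (auto simp: B_def)
    finally have "real (count_eigenvalues_exceeding X \<epsilon>) \<le> K"
      unfolding K_def pos_le_divide_eq[OF \<epsilon>] by (simp only: mult.commute)
    then show ?thesis
      unfolding eq by (simp add: le_nat_floor)
  qed
  then show "\<exists>N M. \<forall>n>N.
      count_eigenvalues_exceeding (toeplitz_mat a n - embedding_schur a (b0 n) n) \<epsilon> \<le> M"
    by blast
qed

end
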